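(* Let $\hbar>0$, $\nu>\hbar/2$ and $\Sigma_\nu=\nu\,\mathbb I_2$. The tangent space at $\Sigma_\nu$ of the orbit of $\Sigma_\nu$ under the symplectic congruence action of $\operatorname{Sp}(2,\mathbb R)$ is exactly the traceless sector: $$T_{\Sigma_\nu}\bigl(\operatorname{Sp}(2,\mathbb R)\cdot\Sigma_\nu\bigr)=\{\,Y\Sigma_\nu+\Sigma_\nu Y^{\mathsf T}: Y\in\mathfrak{sp}(2,\mathbb R)\,\}=\operatorname{span}\{E_+,E_\times\}.$$ In particular the radial direction $E_0$ does not lie in this tangent space, i.e. it cannot be generated by a system-only Gaussian unitary.
   Context: The group $\operatorname{Sp}(2,\mathbb R)$ acts on symmetric $2\times 2$ real matrices by $S\cdot\Sigma=S\Sigma S^{\mathsf T}$. It consists of the real $2\times2$ matrices $S$ with $S\Omega S^{\mathsf T}=\Omega$, $\Omega=\begin{pmatrix}0&1\\-1&0\end{pmatrix}$, and $\mathfrak{sp}(2,\mathbb R)$ is its Lie algebra. An infinitesimal system-only Gaussian unitary with generator $Y\in\mathfrak{sp}(2,\mathbb R)$ acts on a covariance matrix by $\delta_Y\Sigma=Y\Sigma+\Sigma Y^{\mathsf T}$. The basis of the space of real symmetric $2\times2$ matrices is $$E_0=\tfrac{1}{\sqrt2}\mathbb I_2,\quad E_+=\tfrac1{\sqrt2}\begin{pmatrix}1&0\\0&-1\end{pmatrix},\quad E_\times=\tfrac1{\sqrt2}\begin{pmatrix}0&1\\1&0\end{pmatrix}.$$ *)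

theory Defs
  imports "HOL-Analysis.Analysis"
begin

definition Omega :: "real^2^2" where
  "Omega = vector [vector [0, 1], vector [- 1, 0]]"

definition Sp2 :: "(real^2^2) set" where
  "Sp2 = {S. S ** Omega ** transpose S = Omega}"

definition congruence_action :: "real^2^2 \<Rightarrow> real^2^2 \<Rightarrow> real^2^2" where
  "congruence_action S \<Sigma> = S ** \<Sigma> ** transpose S"

definition Sp2_orbit :: "real^2^2 \<Rightarrow> (real^2^2) set" where
  "Sp2_orbit \<Sigma> = {congruence_action S \<Sigma> | S. S \<in> Sp2}"

text \<open>
  C-infinity curves on an open set of parameters: the sequence \<open>D\<close> lists the derivatives of all
  orders. The condition is only meaningful as smoothness when \<open>I\<close> is open.
\<close>

definition smooth_curve_on :: "real set \<Rightarrow> (real \<Rightarrow> 'a::real_normed_vector) \<Rightarrow> bool" where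
  "smooth_curve_on I \<gamma> \<longleftrightarrow>
     (\<exists>D :: nat \<Rightarrow> real \<Rightarrow> 'a. D 0 = \<gamma> \<and>
        (\<forall>k. \<forall>t\<in>I. (D k has_vector_derivative D (Suc k) t) (at t)))"

text \<open>
  The tangent space at \<open>p\<close> of a submanifold \<open>M\<close> of a normed space, as a set of vectors of the
  ambient space: the velocities at time 0 of the smooth curves that stay in \<open>M\<close> and pass through
  \<open>p\<close>. Below it is used only for a closed subgroup of the general linear group and for an orbit
  of its action. In both cases a curve that is smooth in the ambient space and stays in \<open>M\<close> is
  also smooth for the manifold structure of \<open>M\<close>, so this is the usual tangent space.
\<close>

definition tangent_space :: "('a::real_normed_vector) set \<Rightarrow> 'a \<Rightarrow> 'a set" where
  "tangent_space M p =
     {v. \<exists>\<epsilon>>0. \<exists>\<gamma>. smooth_curve_on {-\<epsilon><..<\<epsilon>} \<gamma> \<and> (\<forall>t\<in>{-\<epsilon><..<\<epsilon>}. \<gamma> t \<in> M) \<and>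
         \<gamma> 0 = p \<and> (\<gamma> has_vector_derivative v) (at 0)}"

text \<open>The underlying vector space of the Lie algebra, i.e. the tangent space at the identity.\<close>

definition sp2 :: "(real^2^2) set" where
  "sp2 = tangent_space Sp2 (mat 1)"

definition infinitesimal_action :: "real^2^2 \<Rightarrow> real^2^2 \<Rightarrow> real^2^2" where
  "infinitesimal_action Y \<Sigma> = Y ** \<Sigma> + \<Sigma> ** transpose Y"

definition traceless_sector :: "(real^2^2) set" where
  "traceless_sector = {A. transpose A = A \<and> trace A = 0}"

definition E_zero :: "real^2^2" where
  "E_zero = (1 / sqrt 2) *\<^sub>R mat 1"

definition E_plus :: "real^2^2" where
  "E_plus = (1 / sqrt 2) *\<^sub>R vector [vector [1, 0], vector [0, - 1]]"

definition E_times :: "real^2^2" where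
  "E_times = (1 / sqrt 2) *\<^sub>R vector [vector [0, 1], vector [1, 0]]"

definition Sigma_iso :: "real \<Rightarrow> real^2^2" where
  "Sigma_iso \<nu> = \<nu> *\<^sub>R mat 1"

end

theory Submission
  imports Defs
begin

text \<open>
  On \<open>Sp(2,\<real>) = {S. det S = 1}\<close> and on the orbit of \<open>\<nu> I\<close>, which consists of symmetric matrices of
  determinant \<open>\<nu>\<^sup>2\<close>, differentiating the constant determinant at a nonzero multiple of the identity
  shows that velocities are traceless. Conversely, if \<open>A\<close> is symmetric and traceless, then so is
  \<open>Y = A / (2 \<nu>)\<close>, and \<open>exp (t Y)\<close> is a symmetric curve in \<open>Sp(2,\<real>)\<close>; hence
  \<open>\<nu> exp (2 t Y) = exp (t Y) (\<nu> I) (exp (t Y))\<^sup>T\<close> is a curve in the orbit with velocity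
  \<open>A = Y (\<nu> I) + (\<nu> I) Y\<^sup>T\<close>.
\<close>

section \<open>Two-by-two matrices by entries\<close>

lemma mat2_eq_iff:
  fixes A B :: "'a^2^2"
  shows "A = B \<longleftrightarrow> A$1$1 = B$1$1 \<and> A$1$2 = B$1$2 \<and> A$2$1 = B$2$1 \<and> A$2$2 = B$2$2"
  by (auto simp: vec_eq_iff forall_2)

lemma trace_2: "trace (A :: 'a::comm_ring_1^2^2) = A$1$1 + A$2$2"
  by (simp add: trace_def sum_2)

lemma matrix_mult_2:
  fixes A B :: "'a::comm_ring_1^2^2"
  shows "(A ** B)$i$j = A$i$1 * B$1$j + A$i$2 * B$2$j"
  by (simp add: matrix_matrix_mult_def sum_2)

lemma mat_2_nth [simp]:
  "(mat k :: 'a::zero^2^2)$1$1 = k" "(mat k :: 'a^2^2)$1$2 = 0"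
  "(mat k :: 'a^2^2)$2$1 = 0" "(mat k :: 'a^2^2)$2$2 = k"
  by (simp_all add: mat_def)

lemma transpose_nth [simp]: "transpose A $ i $ j = A $ j $ i"
  by (simp add: transpose_def)

text \<open>For every two-by-two matrix \<open>S\<close>, the product
  \<open>S ** Omega ** transpose S\<close> is \<open>Omega\<close> scaled by
  \<open>det S\<close>.\<close>

lemma Sp2_iff_det: "S \<in> Sp2 \<longleftrightarrow> det S = 1"
  by (auto simp: Sp2_def Omega_def mat2_eq_iff matrix_mult_2 det_2 algebra_simps)

lemma traceless_sector_iff: "A \<in> traceless_sector \<longleftrightarrow> A$2$1 = A$1$2 \<and> A$2$2 = - A$1$1"
proof -
  have "transpose A = A \<longleftrightarrow> A$2$1 = A$1$2"
    unfolding mat2_eq_iff transpose_nth by metis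
  then show ?thesis
    by (simp add: traceless_sector_def trace_2 add_eq_0_iff)
qed

section \<open>Constraints on the velocities of curves\<close>

lemma has_vector_derivative_entry:
  fixes \<gamma> :: "real \<Rightarrow> real^'n^'m"
  assumes "(\<gamma> has_vector_derivative v) F"
  shows "((\<lambda>t. \<gamma> t $ i $ j) has_vector_derivative v $ i $ j) F"
  using bounded_linear.has_vector_derivative[OF bounded_linear_vec_nth
      bounded_linear.has_vector_derivative[OF bounded_linear_vec_nth assms]] .

lemma constant_near_0_derivative:
  fixes f :: "real \<Rightarrow> real"
  assumes "(f has_vector_derivative d) (at 0)" "\<epsilon> > 0" "\<And>t. t \<in> {-\<epsilon><..<\<epsilon>} \<Longrightarrow> f t = c"
  shows "d = 0"
proof -
  have "((\<lambda>t. c) has_vector_derivative d) (at 0)"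
    by (rule has_vector_derivative_transform_within_open[OF assms(1), of "{-\<epsilon><..<\<epsilon>}"])
       (use assms in auto)
  then show ?thesis
    using vector_derivative_unique_at[of "\<lambda>t. c" d 0 0] by auto
qed

lemma tangent_spaceI:
  assumes "smooth_curve_on UNIV \<gamma>" "\<And>t. \<gamma> t \<in> M" "\<gamma> 0 = p"
    "(\<gamma> has_vector_derivative v) (at 0)"
  shows "v \<in> tangent_space M p"
proof -
  have "smooth_curve_on {-1<..<1} \<gamma>"
    using assms(1) unfolding smooth_curve_on_def by blast
  then show ?thesis
    unfolding tangent_space_def using assms(2-4) zero_less_one by blast
qed

text \<open>At \<open>c\<close> times the identity the product rule gives the determinant the
  derivative \<open>c * trace v\<close>, which vanishes because the determinant is constant along
  the curve. The scalar is 1 for the Lie algebra and \<open>\<nu>\<close> for the orbit.\<close>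

lemma trace_tangent_space_eq_0:
  fixes M :: "(real^2^2) set"
  assumes "v \<in> tangent_space M (c *\<^sub>R mat 1)" "c \<noteq> 0" "\<And>A. A \<in> M \<Longrightarrow> det A = d"
  shows "trace v = 0"
proof -
  obtain \<epsilon> \<gamma> where \<epsilon>: "\<epsilon> > 0" and M: "\<forall>t\<in>{-\<epsilon><..<\<epsilon>}. \<gamma> t \<in> M"
    and 0: "\<gamma> 0 = c *\<^sub>R mat 1" and v: "(\<gamma> has_vector_derivative v) (at 0)"
    using assms(1) unfolding tangent_space_def by blast
  have entry: "((\<lambda>t. \<gamma> t $ i $ j) has_real_derivative v $ i $ j) (at 0)" for i j
    using has_vector_derivative_entry[OF v] by (simp add: has_real_derivative_iff_has_vector_derivative)
  have "((\<lambda>t. det (\<gamma> t)) has_real_derivative c * trace v) (at 0)"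
    unfolding det_2
    by (rule derivative_eq_intros entry refl)+ (simp add: 0 trace_2 algebra_simps)
  then have "c * trace v = 0"
    by (intro constant_near_0_derivative[of "\<lambda>t. det (\<gamma> t)" _ \<epsilon> d])
       (use \<epsilon> M assms(3) in \<open>auto simp: has_real_derivative_iff_has_vector_derivative\<close>)
  then show ?thesis using assms(2) by simp
qed

text \<open>Differences of transposed entries are 0 along the curve, hence so are their
  derivatives.\<close>

lemma tangent_space_symmetric:
  fixes M :: "(real^'n^'n) set"
  assumes "v \<in> tangent_space M p" "\<And>A. A \<in> M \<Longrightarrow> transpose A = A"
  shows "transpose v = v"
proof -
  obtain \<epsilon> \<gamma> where \<epsilon>: "\<epsilon> > 0" and M: "\<forall>t\<in>{-\<epsilon><..<\<epsilon>}. \<gamma> t \<in> M"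
    and v: "(\<gamma> has_vector_derivative v) (at 0)"
    using assms(1) unfolding tangent_space_def by blast
  have "v $ i $ j = v $ j $ i" for i j
  proof -
    have "((\<lambda>t. \<gamma> t $ i $ j - \<gamma> t $ j $ i) has_vector_derivative v $ i $ j - v $ j $ i) (at 0)"
      by (intro has_vector_derivative_diff has_vector_derivative_entry v)
    moreover have "\<gamma> t $ i $ j - \<gamma> t $ j $ i = 0" if "t \<in> {-\<epsilon><..<\<epsilon>}" for t
      using assms(2) M that transpose_nth[of "\<gamma> t" i j] by simp
    ultimately have "v $ i $ j - v $ j $ i = 0"
      using constant_near_0_derivative \<epsilon> by blast
    then show ?thesis by simp
  qed
  then show ?thesis by (simp add: vec_eq_iff)
qed

section \<open>Exponential curves of symmetric traceless matrices\<close>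

text \<open>
  The exponential of \<open>t Y\<close> for symmetric traceless \<open>Y\<close>: then \<open>Y\<^sup>2 = r\<^sup>2 I\<close>, and the two summands are
  the spectral components for the eigenvalues \<open>\<plusminus>r\<close>. For \<open>r = 0\<close>, i.e. \<open>Y = 0\<close>, the value
  \<open>1 / 0 = 0\<close> makes the formula give the identity.
\<close>

definition symexp :: "real^2^2 \<Rightarrow> real \<Rightarrow> real^2^2" where
  "symexp Y t = (let r = sqrt ((Y$1$1)\<^sup>2 + (Y$1$2)\<^sup>2) in
     exp (r * t) *\<^sub>R ((1/2) *\<^sub>R (mat 1 + (1/r) *\<^sub>R Y))
     + exp (- r * t) *\<^sub>R ((1/2) *\<^sub>R (mat 1 - (1/r) *\<^sub>R Y)))"

text \<open>Each differentiation multiplies the two summands by \<open>r\<close> and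
  \<open>s\<close>, so derivatives of all orders have a closed form.\<close>

lemma smooth_curve_on_two_exp:
  "smooth_curve_on I (\<lambda>t. exp (r * t) *\<^sub>R P + exp (s * t) *\<^sub>R Q)"
proof -
  let ?D = "\<lambda>k t. (r ^ k * exp (r * t)) *\<^sub>R P + (s ^ k * exp (s * t)) *\<^sub>R Q"
  have "(?D k has_vector_derivative ?D (Suc k) t) (at t)" for k t
    by (rule derivative_eq_intros refl | simp add: algebra_simps)+
  then show ?thesis
    unfolding smooth_curve_on_def by (intro exI[of _ ?D]) auto
qed

text \<open>The scalar \<open>c\<close> is absorbed into the two matrix coefficients. It serves the
  orbit curve, which is \<open>\<nu>\<close> times an exponential.\<close>

lemma smooth_symexp: "smooth_curve_on I (\<lambda>t. c *\<^sub>R symexp Y t)"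
  unfolding symexp_def Let_def scaleR_right_distrib[of c] scaleR_left_commute[of c]
  by (rule smooth_curve_on_two_exp)

lemma symexp_0: "symexp Y 0 = mat 1"
proof -
  have "(1/2) *\<^sub>R (A + B) + (1/2) *\<^sub>R (A - B) = A" for A B :: "real^2^2"
    by (simp flip: scaleR_right_distrib scaleR_2)
  then show ?thesis
    by (simp add: symexp_def Let_def)
qed

context
  fixes Y :: "real^2^2"
  assumes Y: "Y \<in> traceless_sector"
begin

lemma symexp_derivative_0: "(symexp Y has_vector_derivative Y) (at 0)"
proof -
  define r where "r = sqrt ((Y$1$1)\<^sup>2 + (Y$1$2)\<^sup>2)"
  \<comment> \<open>For \<open>r = 0\<close> the velocity computed below is 0, so that case rests on
    \<open>Y\<close> being 0 as well.\<close>
  have Y0: "Y = 0" if "r = 0"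
    using that Y by (simp add: r_def mat2_eq_iff traceless_sector_iff)
  have "((\<lambda>t. exp (r * t) *\<^sub>R ((1/2) *\<^sub>R (mat 1 + (1/r) *\<^sub>R Y))
      + exp (- r * t) *\<^sub>R ((1/2) *\<^sub>R (mat 1 - (1/r) *\<^sub>R Y))) has_vector_derivative
      r *\<^sub>R ((1/2) *\<^sub>R (mat 1 + (1/r) *\<^sub>R Y)) + (- r) *\<^sub>R ((1/2) *\<^sub>R (mat 1 - (1/r) *\<^sub>R Y))) (at 0)"
    by (rule derivative_eq_intros refl | simp)+
  moreover have "r *\<^sub>R ((1/2) *\<^sub>R (mat 1 + (1/r) *\<^sub>R Y)) + (- r) *\<^sub>R ((1/2) *\<^sub>R (mat 1 - (1/r) *\<^sub>R Y)) = Y"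
    using Y0 by (cases "r = 0") (auto simp: mat2_eq_iff field_simps)
  ultimately show ?thesis
    by (simp add: symexp_def[abs_def] Let_def r_def)
qed

text \<open>Here \<open>x\<close> and \<open>y\<close> are the first row of \<open>Y\<close> divided
  by \<open>r\<close>, a unit vector unless \<open>Y = 0\<close>. In this form the group law and the
  determinant become polynomial identities in the exponentials.\<close>

lemma symexp_entries:
  obtains r x y where
    "\<And>t. symexp Y t $1$1 = (exp (r * t) * (1 + x) + exp (- r * t) * (1 - x)) / 2"
    "\<And>t. symexp Y t $1$2 = (exp (r * t) * y - exp (- r * t) * y) / 2"
    "\<And>t. symexp Y t $2$1 = (exp (r * t) * y - exp (- r * t) * y) / 2"
    "\<And>t. symexp Y t $2$2 = (exp (r * t) * (1 - x) + exp (- r * t) * (1 + x)) / 2"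
    "r = 0 \<and> x = 0 \<and> y = 0 \<or> x * x + y * y = 1"
proof -
  define r where "r = sqrt ((Y$1$1)\<^sup>2 + (Y$1$2)\<^sup>2)"
  define x y where "x = Y$1$1 / r" and "y = Y$1$2 / r"
  have "x * x + y * y = ((Y$1$1)\<^sup>2 + (Y$1$2)\<^sup>2) / r\<^sup>2"
    by (simp add: x_def y_def power2_eq_square add_divide_distrib)
  also have "\<dots> = r\<^sup>2 / r\<^sup>2"
    by (simp add: r_def)
  finally have "r = 0 \<and> x = 0 \<and> y = 0 \<or> x * x + y * y = 1"
    by (cases "r = 0") (auto simp: x_def y_def)
  then show ?thesis
    using Y by (intro that[of r x y])
      (simp_all add: symexp_def Let_def x_def y_def traceless_sector_iff
        diff_divide_distrib add_divide_distrib flip: r_def)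
qed

lemma transpose_symexp: "transpose (symexp Y t) = symexp Y t"
  by (rule symexp_entries) (simp only: mat2_eq_iff transpose_nth)

text \<open>For nonzero \<open>Y\<close> the coefficients of the two exponentials are complementary
  projections with product 0, so only the scalar exponentials multiply. This is checked entry by
  entry.\<close>

lemma symexp_mult: "symexp Y s ** symexp Y t = symexp Y (s + t)"
proof -
  obtain r x y where eq: "\<And>t. symexp Y t $1$1 = (exp (r * t) * (1 + x) + exp (- r * t) * (1 - x)) / 2"
    "\<And>t. symexp Y t $1$2 = (exp (r * t) * y - exp (- r * t) * y) / 2"
    "\<And>t. symexp Y t $2$1 = (exp (r * t) * y - exp (- r * t) * y) / 2"
    "\<And>t. symexp Y t $2$2 = (exp (r * t) * (1 - x) + exp (- r * t) * (1 + x)) / 2"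
    and rxy: "r = 0 \<and> x = 0 \<and> y = 0 \<or> x * x + y * y = 1"
    by (rule symexp_entries) (rule that)
  from rxy show ?thesis
  proof
    assume "r = 0 \<and> x = 0 \<and> y = 0"
    then show ?thesis
      by (simp add: eq mat2_eq_iff matrix_mult_2)
  next
    assume xy: "x * x + y * y = 1"
    have e: "exp (r * (s + t)) = exp (r * s) * exp (r * t)"
        "exp (- r * (s + t)) = exp (- r * s) * exp (- r * t)"
      by (simp_all add: exp_add[symmetric] algebra_simps)
    \<comment> \<open>Clearing denominators leaves polynomial identities, with the exponentials as
      atoms for \<open>algebra\<close>.\<close>
    have halves: "(A / 2) * (B / 2) + (C / 2) * (D / 2) = E / 2"
      if "A * B + C * D = 2 * E" for A B C D E :: real
      using that by (simp add: field_simps)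
    show ?thesis
      unfolding eq e mat2_eq_iff matrix_mult_2
      by (intro conjI halves) (use xy in algebra)+
  qed
qed

text \<open>For nonzero \<open>Y\<close> the eigenvalues are \<open>exp (r * t)\<close> and
  \<open>exp (- r * t)\<close>, whose product is 1.\<close>

lemma symexp_in_Sp2: "symexp Y t \<in> Sp2"
proof -
  obtain r x y where eq: "\<And>t. symexp Y t $1$1 = (exp (r * t) * (1 + x) + exp (- r * t) * (1 - x)) / 2"
    "\<And>t. symexp Y t $1$2 = (exp (r * t) * y - exp (- r * t) * y) / 2"
    "\<And>t. symexp Y t $2$1 = (exp (r * t) * y - exp (- r * t) * y) / 2"
    "\<And>t. symexp Y t $2$2 = (exp (r * t) * (1 - x) + exp (- r * t) * (1 + x)) / 2"
    and rxy: "r = 0 \<and> x = 0 \<and> y = 0 \<or> x * x + y * y = 1"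
    by (rule symexp_entries) (rule that)
  from rxy have "det (symexp Y t) = 1"
  proof
    assume "r = 0 \<and> x = 0 \<and> y = 0"
    then show ?thesis
      by (simp add: eq det_2)
  next
    assume xy: "x * x + y * y = 1"
    have e: "exp (r * t) * exp (- r * t) = 1"
      by (simp add: exp_minus)
    have quarters: "(A / 2) * (B / 2) - (C / 2) * (D / 2) = 1"
      if "A * B - C * D = 4" for A B C D :: real
      using that by (simp add: field_simps)
    show ?thesis
      unfolding eq det_2 by (rule quarters) (use xy e in algebra)
  qed
  then show ?thesis by (simp add: Sp2_iff_det)
qed

end

section \<open>The Lie algebra and its infinitesimal action\<close>

lemma traceless_sector_imp_sp2:
  assumes "Y \<in> traceless_sector"
  shows "Y \<in> sp2"
proof -
  have "smooth_curve_on UNIV (symexp Y)"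
    using smooth_symexp[of _ 1] by simp
  then show ?thesis
    unfolding sp2_def
    by (rule tangent_spaceI)
       (simp_all add: symexp_0 symexp_in_Sp2[OF assms] symexp_derivative_0[OF assms])
qed

lemma trace_sp2:
  assumes "Y \<in> sp2"
  shows "trace Y = 0"
  using trace_tangent_space_eq_0[of Y Sp2 1 1] assms by (simp add: sp2_def Sp2_iff_det)

lemma scaleR_traceless_sector:
  "A \<in> traceless_sector \<Longrightarrow> c *\<^sub>R A \<in> traceless_sector"
  by (simp add: traceless_sector_iff)

lemma infinitesimal_action_Sigma_iso:
  "infinitesimal_action Y (Sigma_iso \<nu>) = \<nu> *\<^sub>R (Y + transpose Y)"
  by (simp add: infinitesimal_action_def Sigma_iso_def mat2_eq_iff matrix_mult_2 algebra_simps)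

text \<open>The action is \<open>\<nu>\<close> times \<open>Y + transpose Y\<close>, so the
  antisymmetric part of \<open>Y\<close> drops out. Trace zero on \<open>sp2\<close> bounds the
  image, and symmetric traceless generators already fill it.\<close>

lemma infinitesimal_action_image:
  assumes "\<nu> \<noteq> 0"
  shows "{infinitesimal_action Y (Sigma_iso \<nu>) | Y. Y \<in> sp2} = traceless_sector"
proof (intro subset_antisym subsetI)
  fix A assume "A \<in> {infinitesimal_action Y (Sigma_iso \<nu>) | Y. Y \<in> sp2}"
  then obtain Y where "A = \<nu> *\<^sub>R (Y + transpose Y)" "trace Y = 0"
    using trace_sp2 infinitesimal_action_Sigma_iso by blast
  then show "A \<in> traceless_sector"
    by (simp add: traceless_sector_iff trace_2 add_eq_0_iff)
next
  fix A assume A: "A \<in> traceless_sector"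
  then have "(1 / (2 * \<nu>)) *\<^sub>R A \<in> sp2"
    by (intro traceless_sector_imp_sp2 scaleR_traceless_sector)
  moreover have "infinitesimal_action ((1 / (2 * \<nu>)) *\<^sub>R A) (Sigma_iso \<nu>) = A"
    using A assms
    by (simp add: infinitesimal_action_Sigma_iso mat2_eq_iff traceless_sector_iff)
  ultimately show "A \<in> {infinitesimal_action Y (Sigma_iso \<nu>) | Y. Y \<in> sp2}"
    by (metis (mono_tags, lifting) mem_Collect_eq)
qed

section \<open>The tangent space of the orbit\<close>

lemma congruence_action_Sigma_iso:
  "congruence_action S (Sigma_iso \<nu>) = \<nu> *\<^sub>R (S ** transpose S)"
  by (simp add: congruence_action_def Sigma_iso_def mat2_eq_iff matrix_mult_2 algebra_simps)

lemma tangent_space_Sp2_orbit: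
  assumes "\<nu> \<noteq> 0"
  shows "tangent_space (Sp2_orbit (Sigma_iso \<nu>)) (Sigma_iso \<nu>) = traceless_sector"
proof (intro subset_antisym subsetI)
  fix A assume A: "A \<in> tangent_space (Sp2_orbit (Sigma_iso \<nu>)) (Sigma_iso \<nu>)"
  have "transpose B = B" if "B \<in> Sp2_orbit (Sigma_iso \<nu>)" for B
    using that by (auto simp: Sp2_orbit_def congruence_action_Sigma_iso mat2_eq_iff matrix_mult_2)
  moreover have "det B = \<nu>\<^sup>2" if "B \<in> Sp2_orbit (Sigma_iso \<nu>)" for B
  proof -
    obtain S where "det S = 1" and B: "B = congruence_action S (Sigma_iso \<nu>)"
      using \<open>B \<in> Sp2_orbit (Sigma_iso \<nu>)\<close> by (auto simp: Sp2_orbit_def Sp2_iff_det)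
    then show ?thesis
      by (simp add: congruence_action_def det_mul Sigma_iso_def)
         (simp add: det_2 power2_eq_square)
  qed
  ultimately show "A \<in> traceless_sector"
    using A tangent_space_symmetric[of A] trace_tangent_space_eq_0[of A _ \<nu>] assms
    unfolding traceless_sector_def Sigma_iso_def by blast
next
  fix A assume "A \<in> traceless_sector"
  \<comment> \<open>The factor is \<open>1 / \<nu>\<close> and the parameter is halved below:
    \<open>symexp ?Y (t/2)\<close> squares to \<open>symexp ?Y t\<close>, whose velocity at 0 is
    \<open>A\<close> divided by \<open>\<nu>\<close>.\<close>
  then have Y: "(1 / \<nu>) *\<^sub>R A \<in> traceless_sector" (is "?Y \<in> _")
    by (rule scaleR_traceless_sector)
  define \<gamma> where "\<gamma> t = \<nu> *\<^sub>R symexp ?Y t" for t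
  have "\<gamma> t = congruence_action (symexp ?Y (t/2)) (Sigma_iso \<nu>)" for t
    by (simp add: \<gamma>_def congruence_action_Sigma_iso transpose_symexp[OF Y] symexp_mult[OF Y])
  then have "\<gamma> t \<in> Sp2_orbit (Sigma_iso \<nu>)" for t
    using symexp_in_Sp2[OF Y] by (auto simp: Sp2_orbit_def)
  moreover have "smooth_curve_on UNIV \<gamma>"
    using smooth_symexp by (simp add: \<gamma>_def[abs_def])
  moreover have "\<gamma> 0 = Sigma_iso \<nu>"
    by (simp add: \<gamma>_def Sigma_iso_def symexp_0)
  moreover have "(\<gamma> has_vector_derivative A) (at 0)"
    using has_vector_derivative_scaleR[OF DERIV_const[of \<nu>] symexp_derivative_0[OF Y]] assms
    by (simp add: \<gamma>_def[abs_def])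
  ultimately show "A \<in> tangent_space (Sp2_orbit (Sigma_iso \<nu>)) (Sigma_iso \<nu>)"
    by (intro tangent_spaceI)
qed

section \<open>The basis of the traceless sector and the radial direction\<close>

lemma span_E_plus_E_times: "span {E_plus, E_times} = traceless_sector"
proof (intro subset_antisym subsetI)
  fix A assume "A \<in> span {E_plus, E_times}"
  then obtain a b where "A = a *\<^sub>R E_plus + b *\<^sub>R E_times"
    by (metis (no_types) span_breakdown_eq span_singleton rangeE add.commute diff_eq_eq)
  then show "A \<in> traceless_sector"
    by (simp add: traceless_sector_iff E_plus_def E_times_def)
next
  fix A assume A: "A \<in> traceless_sector"
  \<comment> \<open>The factors \<open>sqrt 2\<close> undo the normalisation of the basis.\<close>
  have "A = (sqrt 2 * A$1$1) *\<^sub>R E_plus + (sqrt 2 * A$1$2) *\<^sub>R E_times"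
    using A by (simp add: E_plus_def E_times_def mat2_eq_iff traceless_sector_iff)
  moreover have "\<dots> \<in> span {E_plus, E_times}"
    by (intro span_add span_scale span_base) auto
  ultimately show "A \<in> span {E_plus, E_times}"
    by simp
qed

text \<open>The trace of \<open>E_zero\<close> is \<open>sqrt 2\<close>.\<close>

lemma E_zero_notin_traceless_sector: "E_zero \<notin> traceless_sector"
  by (simp add: traceless_sector_iff E_zero_def)

theorem proposition3p1:
  fixes hbar \<nu> :: real
  assumes "hbar > 0" and "\<nu> > hbar / 2"
  shows "tangent_space (Sp2_orbit (Sigma_iso \<nu>)) (Sigma_iso \<nu>) = traceless_sector
    \<and> tangent_space (Sp2_orbit (Sigma_iso \<nu>)) (Sigma_iso \<nu>)
        = {infinitesimal_action Y (Sigma_iso \<nu>) | Y. Y \<in> sp2}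
    \<and> {infinitesimal_action Y (Sigma_iso \<nu>) | Y. Y \<in> sp2} = span {E_plus, E_times}
    \<and> E_zero \<notin> tangent_space (Sp2_orbit (Sigma_iso \<nu>)) (Sigma_iso \<nu>)
    \<and> \<not> (\<exists>Y\<in>sp2. infinitesimal_action Y (Sigma_iso \<nu>) = E_zero)"
proof -
  have \<nu>: "\<nu> \<noteq> 0" using assms by auto
  have "infinitesimal_action Y (Sigma_iso \<nu>) \<noteq> E_zero" if "Y \<in> sp2" for Y
  proof
    assume "infinitesimal_action Y (Sigma_iso \<nu>) = E_zero"
    then have "E_zero \<in> {infinitesimal_action Y (Sigma_iso \<nu>) | Y. Y \<in> sp2}"
      using that by (metis (mono_tags, lifting) mem_Collect_eq)
    then show False
      unfolding infinitesimal_action_image[OF \<nu>] using E_zero_notin_traceless_sector by contradiction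
  qed
  then show ?thesis
    unfolding tangent_space_Sp2_orbit[OF \<nu>] infinitesimal_action_image[OF \<nu>] span_E_plus_E_times
    using E_zero_notin_traceless_sector by (intro conjI) auto
qed

end
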